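(* Let $f:\mathbb{R}^n\to\mathbb{R}$ be convex and differentiable with $L_f$-Lipschitz gradient, bounded from below. Let $g_\sigma$, $D_\sigma=\mathrm{Id}-\nabla g_\sigma=\mathrm{Prox}_{\phi_\sigma}$ and $\phi_\sigma$ be as in the context, where the Lipschitz constant $L_{g_\sigma}$ of $\nabla g_\sigma$ verifies $L_{g_\sigma}<1$, and let $M=\frac{L_{g_\sigma}}{L_{g_\sigma}+1}$ be the weak convexity constant of $\phi_\sigma$. Let $\lambda>0$ and $F:=\lambda f+\phi_\sigma$. Then for any $\alpha\in(0,1)$ such that $$\lambda L_f M<1\quad\text{and}\quad M<\alpha<\frac1{\lambda L_f},$$ the iterates given, from $x_0,y_0\in\mathbb{R}^n$ and for $k\ge0$, by $$q_{k+1}=(1-\alpha)y_k+\alpha x_k,\qquad x_{k+1}=D_\sigma\big(x_k-\lambda\nabla f(q_{k+1})\big),\qquad y_{k+1}=(1-\alpha)y_k+\alpha x_{k+1}$$ verify: (i) $F(y_k)+\frac\alpha2\left(1-\frac1\alpha\right)^2\|y_k-y_{k-1}\|^2$, $k\ge1$, is non-increasing and converges; (ii) $\sum_{k=0}^{+\infty}\|y_{k+1}-y_k\|^2<+\infty$ and $\|y_{k+1}-y_k\|$ converges to $0$ at rate $\min_{k<K}\|y_{k+1}-y_k\|=\mathcal{O}(1/\sqrt K)$; (iii) if $g_\sigma$ is coercive, then $(y_k)$ has a subsequence converging to a critical point of $F$.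
   Context: $\|\cdot\|$ is the Euclidean norm. Convention: $\frac1{\lambda L_f}=+\infty$ if $L_f=0$. $\mathrm{Prox}_h(x)=\arg\min_z\frac12\|x-z\|^2+h(z)$. A function $h$ is $M$-weakly convex if $h+\frac M2\|\cdot\|^2$ is convex; coercive if $h(x)\to+\infty$ as $\|x\|\to\infty$. The Fréchet subdifferential is $\hat\partial h(x)=\{\omega:\liminf_{y\to x}\frac{h(y)-h(x)-\langle\omega,y-x\rangle}{\|x-y\|}\ge0\}$; the limiting subdifferential is $\partial h(x)=\{\omega:\exists x_k\to x,\ h(x_k)\to h(x),\ \omega_k\to\omega,\ \omega_k\in\hat\partial h(x_k)\}$. A critical point of $F$ is a point $x$ with $0\in\partial F(x)$. Denoiser potential: $g_\sigma(x)=\frac12\|x-N_\sigma(x)\|^2$ where $N_\sigma:\mathbb{R}^n\to\mathbb{R}^n$ is a ($\mathcal C^\infty$) neural network with softplus activations $s_\epsilon(t)=\frac1\epsilon\log(1+e^{\epsilon t})$, $\epsilon>0$, i.e. an element of the smallest class of maps between Euclidean spaces containing affine maps and coordinatewise applications of $s_\epsilon$ and closed under composition, sums and concatenation. Assume $\nabla g_\sigma$ is $L_{g_\sigma}$-Lipschitz with $0\le L_{g_\sigma}<1$. Then $D_\sigma:=\mathrm{Id}-\nabla g_\sigma$ is injective, and $\phi_\sigma:\mathbb{R}^n\to\mathbb{R}\cup\{+\infty\}$ denotes a function (which exists) that is $\frac{L_{g_\sigma}}{L_{g_\sigma}+1}$-weakly convex, satisfies $\mathrm{Prox}_{\phi_\sigma}(x)=\{D_\sigma(x)\}$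 for all $x$, and for some constant $K\in\mathbb{R}$ satisfies $\phi_\sigma(x)=g_\sigma(D_\sigma^{-1}(x))-\frac12\|D_\sigma^{-1}(x)-x\|^2+K$ for all $x\in\mathrm{Im}(D_\sigma)$. *)

theory Defs
  imports
    "Jordan_Normal_Form.Matrix"
    "HOL-Analysis.Analysis"
    "HOL-Library.Landau_Symbols"
begin

definition gradient :: "('a::real_inner \<Rightarrow> real) \<Rightarrow> 'a \<Rightarrow> 'a" where
  "gradient h x = (THE d. GDERIV h x :> d)"

definition prox :: "('a::real_normed_vector \<Rightarrow> ereal) \<Rightarrow> 'a \<Rightarrow> 'a set" where
  "prox h x = {z. is_arg_min (\<lambda>z. ereal (1/2 * (norm (x - z))\<^sup>2) + h z) (\<lambda>_. True) z}"

text \<open>Only meant for functions that avoid the value \<open>-\<infinity>\<close>; recall that \<open>0 * \<infinity> = 0\<close> in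
  \<^typ>\<open>ereal\<close>, so the endpoints \<open>t = 0\<close> and \<open>t = 1\<close> are harmless.\<close>

definition ereal_convex :: "('a::real_vector \<Rightarrow> ereal) \<Rightarrow> bool" where
  "ereal_convex h \<longleftrightarrow> (\<forall>x y. \<forall>t\<in>{0..1::real}.
     h ((1 - t) *\<^sub>R x + t *\<^sub>R y) \<le> ereal (1 - t) * h x + ereal t * h y)"

definition weakly_convex :: "real \<Rightarrow> ('a::real_normed_vector \<Rightarrow> ereal) \<Rightarrow> bool" where
  "weakly_convex M h \<longleftrightarrow> ereal_convex (\<lambda>x. h x + ereal (M / 2 * (norm x)\<^sup>2))"

definition coercive :: "('a::real_normed_vector \<Rightarrow> real) \<Rightarrow> bool" where
  "coercive h \<longleftrightarrow> filterlim h at_top at_infinity"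

text \<open>Both subdifferentials are empty, as usual, at points where the function is not finite.\<close>

definition frechet_subdifferential :: "('a::real_inner \<Rightarrow> ereal) \<Rightarrow> 'a \<Rightarrow> 'a set" where
  "frechet_subdifferential h x = {w. \<bar>h x\<bar> \<noteq> \<infinity> \<and>
     0 \<le> Liminf (at x) (\<lambda>y. (h y - h x - ereal (inner w (y - x))) / ereal (norm (x - y)))}"

definition limiting_subdifferential :: "('a::real_inner \<Rightarrow> ereal) \<Rightarrow> 'a \<Rightarrow> 'a set" where
  "limiting_subdifferential h x = {w. \<bar>h x\<bar> \<noteq> \<infinity> \<and>
     (\<exists>X W. X \<longlonglongrightarrow> x \<and> (\<lambda>k. h (X k)) \<longlonglongrightarrow> h x \<and> W \<longlonglongrightarrow> w \<and>
       (\<forall>k::nat. W k \<in> frechet_subdifferential h (X k)))}"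

definition critical_point :: "('a::real_inner \<Rightarrow> ereal) \<Rightarrow> 'a \<Rightarrow> bool" where
  "critical_point h x \<longleftrightarrow> 0 \<in> limiting_subdifferential h x"

definition softplus :: "real \<Rightarrow> real \<Rightarrow> real" where
  "softplus \<epsilon> t = 1 / \<epsilon> * ln (1 + exp (\<epsilon> * t))"

text \<open>The layers of a network have varying widths, so the class is generated on vectors whose
  dimension is a natural number: \<open>softplus_net \<epsilon> n m u\<close> says that \<open>u\<close>, restricted to
  \<^term>\<open>carrier_vec n\<close>, is a network mapping into \<^term>\<open>carrier_vec m\<close>. The values of \<open>u\<close> outside
  \<^term>\<open>carrier_vec n\<close> are meaningless.\<close>

inductive softplus_net ::
  "real \<Rightarrow> nat \<Rightarrow> nat \<Rightarrow> (real Matrix.vec \<Rightarrow> real Matrix.vec) \<Rightarrow> bool" for \<epsilon> :: real where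
  affine: "A \<in> carrier_mat m n \<Longrightarrow> b \<in> carrier_vec m \<Longrightarrow>
    softplus_net \<epsilon> n m (\<lambda>v. A *\<^sub>v v + b)"
| activation: "softplus_net \<epsilon> n n (map_vec (softplus \<epsilon>))"
| compose: "softplus_net \<epsilon> n m u \<Longrightarrow> softplus_net \<epsilon> m p w \<Longrightarrow> softplus_net \<epsilon> n p (w \<circ> u)"
| sum: "softplus_net \<epsilon> n m u \<Longrightarrow> softplus_net \<epsilon> n m w \<Longrightarrow> softplus_net \<epsilon> n m (\<lambda>v. u v + w v)"
| concat: "softplus_net \<epsilon> n m u \<Longrightarrow> softplus_net \<epsilon> n p w \<Longrightarrow>
    softplus_net \<epsilon> n (m + p) (\<lambda>v. u v @\<^sub>v w v)"

definition coordinates :: "(nat \<Rightarrow> 'n) \<Rightarrow> real ^ 'n::finite \<Rightarrow> real Matrix.vec" where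
  "coordinates e x = Matrix.vec CARD('n) (\<lambda>i. vec_nth x (e i))"

text \<open>The choice of the enumeration \<open>e\<close> of the coordinates is immaterial, because permutations of
  coordinates are linear and hence networks.\<close>

definition softplus_network :: "real \<Rightarrow> (real ^ 'n::finite \<Rightarrow> real ^ 'n) \<Rightarrow> bool" where
  "softplus_network \<epsilon> N \<longleftrightarrow> (\<exists>e u. bij_betw e {..<CARD('n)} (UNIV :: 'n set) \<and>
     softplus_net \<epsilon> CARD('n) CARD('n) u \<and> (\<forall>x. coordinates e (N x) = u (coordinates e x)))"

definition denoiser_potential :: "('a::real_normed_vector \<Rightarrow> 'a) \<Rightarrow> 'a \<Rightarrow> real" where
  "denoiser_potential N x = 1/2 * (norm (x - N x))\<^sup>2"

definition denoiser :: "('a::real_inner \<Rightarrow> 'a) \<Rightarrow> 'a \<Rightarrow> 'a" where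
  "denoiser N x = x - gradient (denoiser_potential N) x"

text \<open>\<open>denoiser_prox_potential N L \<phi>\<close>: the function \<open>\<phi>\<close> with values in the reals extended by
  \<open>+\<infinity>\<close> is a potential whose proximal map is the denoiser, where \<open>L < 1\<close> is a Lipschitz constant
  of the gradient of \<^term>\<open>denoiser_potential N\<close>.\<close>

definition denoiser_prox_potential ::
  "('a::real_inner \<Rightarrow> 'a) \<Rightarrow> real \<Rightarrow> ('a \<Rightarrow> ereal) \<Rightarrow> bool" where
  "denoiser_prox_potential N L \<phi> \<longleftrightarrow>
     (\<forall>x. \<phi> x \<noteq> -\<infinity>) \<and>
     weakly_convex (L / (L + 1)) \<phi> \<and>
     (\<forall>x. prox \<phi> x = {denoiser N x}) \<and>
     (\<exists>K::real. \<forall>x \<in> range (denoiser N).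
        \<phi> x = ereal (denoiser_potential N (inv_into UNIV (denoiser N) x)
                       - 1/2 * (norm (inv_into UNIV (denoiser N) x - x))\<^sup>2 + K))"

end

theory Submission
  imports Defs
begin

text \<open>
  Since \<open>\<nabla>g\<close> is a contraction, \<open>D = Id - \<nabla>g\<close> is a bijection with a Lipschitz inverse \<open>S\<close>, so the
  explicit formula for \<open>\<phi>\<close> on the range of \<open>D\<close> makes \<open>\<phi>\<close> finite everywhere:
  \<open>\<phi> = p\<close> with \<open>p\<close> real valued. Everything about \<open>\<phi>\<close> can then be done with smooth functions. That
  \<open>z = D (S z)\<close> minimises \<open>1/2 \<parallel>S z - w\<parallel>\<^sup>2 + p w\<close> over \<open>w\<close> bounds \<open>p\<close> from below by a quadratic
  with slope \<open>S z - z\<close> at \<open>z\<close>; exchanging the two points gives an upper bound of the same kind, because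
  \<open>S\<close> is Lipschitz. Hence \<open>\<nabla>p = S - Id\<close> is continuous (\<open>gderiv_of_prox_surjective\<close>), and the step
  \<open>x\<^sub>k\<^sub>+\<^sub>1 = D (x\<^sub>k - \<lambda> \<nabla>f (q\<^sub>k\<^sub>+\<^sub>1))\<close> is the implicit gradient step
  \<open>x\<^sub>k\<^sub>+\<^sub>1 + \<nabla>p (x\<^sub>k\<^sub>+\<^sub>1) = x\<^sub>k - \<lambda> \<nabla>f (q\<^sub>k\<^sub>+\<^sub>1)\<close>. Moreover the descent lemma for \<open>g\<close> between \<open>S z\<close> and
  \<open>z = S z - \<nabla>g (S z)\<close> gives \<open>g + K \<le> p\<close>, so that \<open>p\<close> inherits from \<open>g \<ge> 0\<close> a lower bound
  and from \<open>g\<close>, if it is coercive, bounded sublevel sets. This is where the network structure enters: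
  it makes \<open>g\<close> differentiable.

  The heart is a one-step estimate (\<open>objective_step\<close>). Put \<open>a = x\<^sub>k - x\<^sub>k\<^sub>+\<^sub>1\<close> and \<open>b = y\<^sub>k - x\<^sub>k\<^sub>+\<^sub>1\<close>.
  Weak convexity bounds \<open>p\<close> at the convex combination \<open>y\<^sub>k\<^sub>+\<^sub>1\<close> of \<open>y\<^sub>k\<close> and \<open>x\<^sub>k\<^sub>+\<^sub>1\<close>, and
  \<open>p (x\<^sub>k\<^sub>+\<^sub>1)\<close> in terms of \<open>p (y\<^sub>k)\<close>; convexity and smoothness of \<open>f\<close>, both used at the
  point \<open>q\<^sub>k\<^sub>+\<^sub>1\<close>, bound \<open>f (y\<^sub>k\<^sub>+\<^sub>1) - f (y\<^sub>k)\<close>. The terms with \<open>\<nabla>f (q\<^sub>k\<^sub>+\<^sub>1)\<close> cancel, and the remaining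
  \<open>-\<alpha> \<langle>a, b\<rangle>\<close> splits into squares by polarisation. The square of \<open>a\<close> has the right sign
  because \<open>\<alpha> \<lambda> L\<^sub>f \<le> 1\<close>; since \<open>b\<close> and \<open>a - b = x\<^sub>k - y\<^sub>k\<close> are multiples of \<open>y\<^sub>k\<^sub>+\<^sub>1 - y\<^sub>k\<close> and
  \<open>y\<^sub>k - y\<^sub>k\<^sub>-\<^sub>1\<close>, what is left is a decrease of the Lyapunov function by
  \<open>(2 - \<alpha>) (\<alpha> - M) / (2 \<alpha>) \<parallel>y\<^sub>k\<^sub>+\<^sub>1 - y\<^sub>k\<parallel>\<^sup>2\<close>, with a positive factor because \<open>\<alpha> > M\<close>.
  Telescoping gives convergence, summability and the rate. Passing to the limit in the implicit gradient
  step along a convergent subsequence gives \<open>\<lambda> \<nabla>f z + \<nabla>p z = 0\<close>, which is criticality.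
\<close>

section \<open>Differentiable and weakly convex functions\<close>

lemma gderiv_unique:
  assumes "GDERIV h x :> d" and "GDERIV h x :> d'"
  shows "d = d'"
proof -
  have "(\<lambda>v. inner v d) = (\<lambda>v. inner v d')"
    using assms unfolding gderiv_def by (rule has_derivative_unique)
  then show ?thesis
    by (metis vector_eq_ldot)
qed

lemma gderiv_gradient:
  fixes h :: "'a::euclidean_space \<Rightarrow> real"
  assumes "h differentiable (at x)"
  shows "GDERIV h x :> gradient h x"
proof -
  obtain A where A: "(h has_derivative A) (at x)"
    using assms by (auto simp: differentiable_def)
  interpret bounded_linear A
    using A by (rule has_derivative_bounded_linear)
  define d where "d = (\<Sum>b\<in>Basis. A b *\<^sub>R b)"
  have "A v = inner v d" for v
  proof -
    have "A v = A (\<Sum>b\<in>Basis. inner v b *\<^sub>R b)"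
      by (simp add: euclidean_representation)
    also have "\<dots> = inner v d"
      by (simp add: sum scaleR d_def inner_sum_right mult.commute)
    finally show ?thesis .
  qed
  then have "A = (\<lambda>v. inner v d)" by (rule ext)
  with A have d: "GDERIV h x :> d"
    by (simp add: gderiv_def)
  have "gradient h x = d"
    unfolding gradient_def using d gderiv_unique by (blast intro: the_equality)
  with d show ?thesis by simp
qed

lemma gderiv_along_line:
  assumes "GDERIV h (a + t *\<^sub>R d) :> g"
  shows "((\<lambda>t. h (a + t *\<^sub>R d)) has_real_derivative inner d g) (at t)"
proof -
  have "((\<lambda>t. a + t *\<^sub>R d) has_derivative (\<lambda>s. s *\<^sub>R d)) (at t)"
    by (auto intro!: derivative_eq_intros)
  then have "((\<lambda>t. h (a + t *\<^sub>R d)) has_derivative (\<lambda>s. inner (s *\<^sub>R d) g)) (at t)"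
    using assms unfolding gderiv_def by (rule has_derivative_compose)
  then show ?thesis
    by (simp add: has_field_derivative_def mult_commute_abs)
qed

lemma convex_gradient_lower_bound:
  fixes h :: "'a::real_inner \<Rightarrow> real"
  assumes "convex_on UNIV h" and "GDERIV h x :> g"
  shows "h x + inner g (w - x) \<le> h w"
proof -
  let ?l = "\<lambda>t::real. h (x + t *\<^sub>R (w - x))"
  have "convex_on UNIV ?l"
  proof (rule convex_onI)
    fix t a b :: real
    assume t: "0 < t" "t < 1"
    have eq: "x + ((1 - t) *\<^sub>R a + t *\<^sub>R b) *\<^sub>R (w - x)
        = (1 - t) *\<^sub>R (x + a *\<^sub>R (w - x)) + t *\<^sub>R (x + b *\<^sub>R (w - x))"
      by (simp add: algebra_simps)
    show "?l ((1 - t) *\<^sub>R a + t *\<^sub>R b) \<le> (1 - t) * ?l a + t * ?l b"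
      unfolding eq using convex_onD[OF assms(1), of t] t by simp
  qed simp
  moreover have "(?l has_real_derivative inner (w - x) g) (at 0)"
    using assms(2) by (intro gderiv_along_line) simp
  ultimately have "inner (w - x) g * (1 - 0) \<le> ?l 1 - ?l 0"
    by (intro convex_on_imp_above_tangent[where A = UNIV]) auto
  then show ?thesis by (simp add: inner_commute)
qed

text \<open>Along the segment from \<open>x\<close> to \<open>w\<close>, the slope of \<open>h\<close> exceeds its initial value by at most
  \<open>L t \<parallel>w - x\<parallel>\<^sup>2\<close> at time \<open>t\<close>; the factor \<open>1/2\<close> comes from integrating \<open>t\<close> over the unit
  interval.\<close>

lemma lipschitz_gradient_upper_bound:
  fixes h :: "'a::real_inner \<Rightarrow> real"
  assumes grad: "\<And>z. GDERIV h z :> dh z" and lip: "L-lipschitz_on UNIV dh"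
  shows "h w \<le> h x + inner (dh x) (w - x) + L / 2 * (norm (w - x))\<^sup>2"
proof -
  define d where "d = w - x"
  define r where "r t = h (x + t *\<^sub>R d) - t * inner d (dh x) - L / 2 * t\<^sup>2 * (norm d)\<^sup>2" for t
  have "r 1 \<le> r 0"
  proof (rule DERIV_nonpos_imp_nonincreasing[of 0 1 r])
    fix t :: real
    assume t: "0 \<le> t" "t \<le> 1"
    let ?D = "inner d (dh (x + t *\<^sub>R d)) - inner d (dh x) - L * t * (norm d)\<^sup>2"
    have "(r has_real_derivative ?D) (at t)"
      unfolding r_def by (rule derivative_eq_intros gderiv_along_line[OF grad] refl | simp)+
    moreover have "?D \<le> 0"
    proof -
      have "inner d (dh (x + t *\<^sub>R d)) - inner d (dh x) \<le> norm d * norm (dh (x + t *\<^sub>R d) - dh x)"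
        unfolding inner_diff_right[symmetric] by (rule norm_cauchy_schwarz)
      also have "\<dots> \<le> norm d * (L * (t * norm d))"
        using lipschitz_onD[OF lip, of "x + t *\<^sub>R d" x] t
        by (intro mult_left_mono) (auto simp: dist_norm)
      finally show ?thesis by (simp add: power2_eq_square mult_ac)
    qed
    ultimately show "\<exists>D. (r has_real_derivative D) (at t) \<and> D \<le> 0" by blast
  qed simp
  then show ?thesis
    by (simp add: r_def d_def inner_commute)
qed

lemma gderiv_of_quadratic_bound:
  fixes h :: "'a::real_inner \<Rightarrow> real"
  assumes "\<And>w. \<bar>h w - h z - inner v (w - z)\<bar> \<le> C * (norm (w - z))\<^sup>2"
  shows "GDERIV h z :> v"
  unfolding gderiv_def has_derivative_iff_norm
proof
  show "bounded_linear (\<lambda>d. inner d v)" by (rule bounded_linear_inner_left)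
  show "((\<lambda>w. norm (h w - h z - inner (w - z) v) / norm (w - z)) \<longlongrightarrow> 0) (at z)"
  proof (rule Lim_null_comparison)
    show "\<forall>\<^sub>F w in at z. norm (norm (h w - h z - inner (w - z) v) / norm (w - z))
        \<le> C * norm (w - z)"
    proof (rule eventually_at_filter[THEN iffD2], intro always_eventually allI impI)
      fix w assume "w \<noteq> z"
      then show "norm (norm (h w - h z - inner (w - z) v) / norm (w - z)) \<le> C * norm (w - z)"
        using assms[of w] by (simp add: inner_commute divide_le_eq power2_eq_square mult_ac)
    qed
    have "((\<lambda>w. C * norm (w - z)) \<longlongrightarrow> C * norm (z - z)) (at z)"
      by (intro tendsto_intros)
    then show "((\<lambda>w. C * norm (w - z)) \<longlongrightarrow> 0) (at z)" by simp
  qed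
qed

lemma gderiv_half_norm_sq: "GDERIV (\<lambda>z. M / 2 * (norm z)\<^sup>2) z :> M *\<^sub>R z"
  unfolding gderiv_def power2_norm_eq_inner
  by (rule derivative_eq_intros refl | simp add: inner_commute)+

lemma weakly_convex_gradient_lower_bound:
  fixes h :: "'a::real_inner \<Rightarrow> real"
  assumes "convex_on UNIV (\<lambda>z. h z + M / 2 * (norm z)\<^sup>2)" and "GDERIV h x :> g"
  shows "h x + inner g (w - x) - M / 2 * (norm (w - x))\<^sup>2 \<le> h w"
proof -
  have "h x + M / 2 * (norm x)\<^sup>2 + inner (g + M *\<^sub>R x) (w - x) \<le> h w + M / 2 * (norm w)\<^sup>2"
    by (rule convex_gradient_lower_bound[OF assms(1) GDERIV_add[OF assms(2) gderiv_half_norm_sq]])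
  moreover have "M / 2 * (norm w)\<^sup>2
      = M / 2 * (norm x)\<^sup>2 + M * inner x (w - x) + M / 2 * (norm (w - x))\<^sup>2"
    unfolding power2_norm_eq_inner by (simp add: inner_diff inner_commute algebra_simps)
  ultimately show ?thesis unfolding inner_add_left inner_scaleR_left by linarith
qed

lemma weakly_convex_combination:
  fixes h :: "'a::real_inner \<Rightarrow> real"
  assumes "convex_on UNIV (\<lambda>z. h z + M / 2 * (norm z)\<^sup>2)" and "0 \<le> t" "t \<le> 1"
  shows "h ((1 - t) *\<^sub>R a + t *\<^sub>R b)
    \<le> (1 - t) * h a + t * h b + M / 2 * (t * (1 - t)) * (norm (a - b))\<^sup>2"
proof -
  let ?c = "(1 - t) *\<^sub>R a + t *\<^sub>R b"
  have "h ?c + M / 2 * (norm ?c)\<^sup>2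
      \<le> (1 - t) * (h a + M / 2 * (norm a)\<^sup>2) + t * (h b + M / 2 * (norm b)\<^sup>2)"
    using convex_onD[OF assms(1)] assms(2,3) by blast
  moreover have "(norm ?c)\<^sup>2 = (1 - t) * (norm a)\<^sup>2 + t * (norm b)\<^sup>2 - t * (1 - t) * (norm (a - b))\<^sup>2"
    unfolding power2_norm_eq_inner
    by (simp add: inner_add inner_diff inner_commute algebra_simps power2_eq_square)
  ultimately have "h ?c + M / 2 * ((1 - t) * (norm a)\<^sup>2 + t * (norm b)\<^sup>2
        - t * (1 - t) * (norm (a - b))\<^sup>2)
      \<le> (1 - t) * (h a + M / 2 * (norm a)\<^sup>2) + t * (h b + M / 2 * (norm b)\<^sup>2)"
    by (simp only:)
  then show ?thesis by (simp add: algebra_simps add_divide_distrib diff_divide_distrib)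
qed

text \<open>The Frechet quotient at \<open>z\<close> is a genuine limit here, and constant sequences carry its value over
  to the limiting subdifferential.\<close>

lemma ereal_gderiv_zero_imp_critical_point:
  fixes h :: "'a::euclidean_space \<Rightarrow> real"
  assumes "GDERIV h z :> 0"
  shows "critical_point (\<lambda>w. ereal (h w)) z"
proof -
  let ?Q = "\<lambda>w. (ereal (h w) - ereal (h z) - ereal (inner 0 (w - z))) / ereal (norm (z - w))"
  have "((\<lambda>w. norm (h w - h z) / norm (w - z)) \<longlongrightarrow> 0) (at z)"
    using assms unfolding gderiv_def has_derivative_iff_norm by simp
  then have "((\<lambda>w. norm ((h w - h z) / norm (w - z))) \<longlongrightarrow> 0) (at z)"
    by simp
  then have "((\<lambda>w. (h w - h z) / norm (w - z)) \<longlongrightarrow> 0) (at z)"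
    by (rule tendsto_norm_zero_cancel)
  then have "((\<lambda>w. ereal ((h w - h z) / norm (w - z))) \<longlongrightarrow> ereal 0) (at z)"
    by (rule tendsto_ereal)
  moreover have "\<forall>\<^sub>F w in at z. ereal ((h w - h z) / norm (w - z)) = ?Q w"
    by (auto simp: eventually_at_filter norm_minus_commute)
  ultimately have "(?Q \<longlongrightarrow> ereal 0) (at z)"
    by (rule Lim_transform_eventually)
  then have "Liminf (at z) ?Q = ereal 0"
    by (rule lim_imp_Liminf[OF trivial_limit_at])
  then have "0 \<le> Liminf (at z) ?Q"
    by (simp only: zero_ereal_def)
  then have zero: "0 \<in> frechet_subdifferential (\<lambda>w. ereal (h w)) z"
    unfolding frechet_subdifferential_def by (intro CollectI conjI; (assumption | simp))
  show ?thesis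
    unfolding critical_point_def limiting_subdifferential_def
    by (rule CollectI, rule conjI, simp, rule exI[of _ "\<lambda>_. z"], rule exI[of _ "\<lambda>_. 0"])
      (simp add: zero)
qed

section \<open>Descent of the relaxed proximal gradient method\<close>

text \<open>The proximal step is recorded as its optimality condition \<open>x_step\<close>, the implicit gradient step
  for \<open>p\<close>.\<close>

locale relaxed_proximal_gradient =
  fixes f p :: "'a::euclidean_space \<Rightarrow> real" and df dp :: "'a \<Rightarrow> 'a"
    and L M lam \<alpha> :: real and q x y :: "nat \<Rightarrow> 'a"
  assumes convex_f: "convex_on UNIV f"
    and gderiv_f: "\<And>z. GDERIV f z :> df z"
    and lipschitz_df: "L-lipschitz_on UNIV df"
    and bdd_below_f: "bdd_below (range f)"
    and weakly_convex_p: "convex_on UNIV (\<lambda>z. p z + M / 2 * (norm z)\<^sup>2)"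
    and gderiv_p: "\<And>z. GDERIV p z :> dp z"
    and continuous_dp: "continuous_on UNIV dp"
    and bdd_below_p: "bdd_below (range p)"
    and lam_pos: "0 < lam" and \<alpha>_pos: "0 < \<alpha>" and \<alpha>_less_1: "\<alpha> < 1"
    and M_less_\<alpha>: "M < \<alpha>" and step_size: "\<alpha> * (lam * L) \<le> 1"
    and q_step: "\<And>k. q (Suc k) = (1 - \<alpha>) *\<^sub>R y k + \<alpha> *\<^sub>R x k"
    and x_step: "\<And>k. x (Suc k) + dp (x (Suc k)) = x k - lam *\<^sub>R df (q (Suc k))"
    and y_step: "\<And>k. y (Suc k) = (1 - \<alpha>) *\<^sub>R y k + \<alpha> *\<^sub>R x (Suc k)"
begin

definition objective :: "'a \<Rightarrow> real" where
  "objective z = lam * f z + p z"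

definition lyapunov :: "nat \<Rightarrow> real" where
  "lyapunov k = objective (y k) + \<alpha> / 2 * (1 - 1 / \<alpha>)\<^sup>2 * (norm (y k - y (k - 1)))\<^sup>2"

definition decrease_rate :: real where
  "decrease_rate = (2 - \<alpha>) * (\<alpha> - M) / (2 * \<alpha>)"

lemma decrease_rate_pos: "0 < decrease_rate"
  using \<alpha>_pos \<alpha>_less_1 M_less_\<alpha> by (simp add: decrease_rate_def)

text \<open>The inner products with \<open>df (q (Suc k))\<close> that come from \<open>f\<close> and from the proximal step cancel,
  because \<open>\<alpha> b = y k - y (Suc k)\<close>.\<close>

lemma objective_step:
  fixes k :: nat
  defines "a \<equiv> x k - x (Suc k)" and "b \<equiv> y k - x (Suc k)"
  shows "objective (y (Suc k)) \<le> objective (y k) + \<alpha> / 2 * (norm (x k - y k))\<^sup>2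
    - \<alpha> / 2 * (1 - \<alpha> * (lam * L)) * (norm a)\<^sup>2 - \<alpha> / 2 * (1 - M * (2 - \<alpha>)) * (norm b)\<^sup>2"
proof -
  define u where "u = df (q (Suc k))"
  have y': "y (Suc k) - q (Suc k) = - (\<alpha> *\<^sub>R a)" and y: "y k - q (Suc k) = \<alpha> *\<^sub>R (b - a)"
    unfolding y_step q_step a_def b_def by (simp_all add: algebra_simps)
  have "f (y (Suc k)) \<le> f (q (Suc k)) - \<alpha> * inner u a + L / 2 * (\<alpha>\<^sup>2 * (norm a)\<^sup>2)"
    using lipschitz_gradient_upper_bound[OF gderiv_f lipschitz_df, of "y (Suc k)" "q (Suc k)"]
    unfolding y' u_def by (simp add: power_mult_distrib)
  moreover have "f (q (Suc k)) + \<alpha> * (inner u b - inner u a) \<le> f (y k)"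
    using convex_gradient_lower_bound[OF convex_f gderiv_f, of "q (Suc k)" "y k"]
    unfolding y u_def by (simp add: inner_diff_right)
  ultimately have "f (y (Suc k)) \<le> f (y k) - \<alpha> * inner u b + L / 2 * (\<alpha>\<^sup>2 * (norm a)\<^sup>2)"
    by (simp add: algebra_simps)
  then have "lam * f (y (Suc k)) \<le> lam * (f (y k) - \<alpha> * inner u b + L / 2 * (\<alpha>\<^sup>2 * (norm a)\<^sup>2))"
    using lam_pos by (intro mult_left_mono) auto
  moreover have "\<alpha> * p (x (Suc k)) \<le> \<alpha> * (p (y k) - inner a b + lam * inner u b + M / 2 * (norm b)\<^sup>2)"
  proof (intro mult_left_mono)
    have "dp (x (Suc k)) = a - lam *\<^sub>R u"
      using x_step[of k] by (simp add: a_def u_def algebra_simps eq_diff_eq)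
    then show "p (x (Suc k)) \<le> p (y k) - inner a b + lam * inner u b + M / 2 * (norm b)\<^sup>2"
      using weakly_convex_gradient_lower_bound[OF weakly_convex_p gderiv_p, of "x (Suc k)" "y k"]
      by (simp add: b_def inner_diff_left)
  qed (use \<alpha>_pos in simp)
  moreover have "p (y (Suc k)) \<le> (1 - \<alpha>) * p (y k) + \<alpha> * p (x (Suc k))
      + M / 2 * (\<alpha> * (1 - \<alpha>)) * (norm b)\<^sup>2"
    unfolding y_step b_def
    using weakly_convex_combination[OF weakly_convex_p] \<alpha>_pos \<alpha>_less_1 by simp
  \<comment> \<open>polarisation, with \<open>a - b = x k - y k\<close>\<close>
  moreover have "\<alpha> * inner a b = \<alpha> * (((norm a)\<^sup>2 + (norm b)\<^sup>2 - (norm (x k - y k))\<^sup>2) / 2)"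
  proof -
    have eq: "x k - y k = a - b" by (simp add: a_def b_def)
    show ?thesis
      unfolding eq power2_norm_eq_inner by (simp add: inner_diff inner_commute)
  qed
  ultimately show ?thesis
    unfolding objective_def by (simp add: algebra_simps power2_eq_square add_divide_distrib diff_divide_distrib)
qed

text \<open>The index must be positive: only then has \<open>y k\<close> been produced by a relaxation step, which makes
  \<open>x k - y k\<close> a multiple of \<open>y k - y (k - 1)\<close>. The inertial term of the Lyapunov function at
  \<open>k\<close> is then \<open>\<alpha>/2 \<parallel>x k - y k\<parallel>\<^sup>2\<close>, the only positive term in the one-step estimate.\<close>

lemma lyapunov_step:
  assumes "1 \<le> k"
  shows "lyapunov (Suc k) \<le> lyapunov k - decrease_rate * (norm (y (Suc k) - y k))\<^sup>2"
proof -
  let ?S = "(norm (y (Suc k) - y k))\<^sup>2"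
  obtain j where k: "k = Suc j"
    using assms by (cases k) auto
  have "\<alpha> *\<^sub>R (x k - y k) = (1 - \<alpha>) *\<^sub>R (y k - y (k - 1))"
    unfolding k by (simp add: y_step algebra_simps)
  moreover have "x k - y k = (1 / \<alpha>) *\<^sub>R (\<alpha> *\<^sub>R (x k - y k))"
    using \<alpha>_pos by simp
  ultimately have "x k - y k = ((1 - \<alpha>) / \<alpha>) *\<^sub>R (y k - y (k - 1))"
    by simp
  then have "(norm (x k - y k))\<^sup>2 = ((1 - \<alpha>) / \<alpha>)\<^sup>2 * (norm (y k - y (k - 1)))\<^sup>2"
    by (simp add: power_mult_distrib power_divide)
  moreover have "((1 - \<alpha>) / \<alpha>)\<^sup>2 = (1 - 1 / \<alpha>)\<^sup>2"
    using \<alpha>_pos by (simp add: field_simps power2_eq_square)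
  ultimately have inertia: "\<alpha> / 2 * (norm (x k - y k))\<^sup>2
      = \<alpha> / 2 * (1 - 1 / \<alpha>)\<^sup>2 * (norm (y k - y (k - 1)))\<^sup>2"
    by simp
  have "y (Suc k) - y k = - (\<alpha> *\<^sub>R (y k - x (Suc k)))"
    by (simp add: y_step algebra_simps)
  then have S: "?S = \<alpha>\<^sup>2 * (norm (y k - x (Suc k)))\<^sup>2"
    by (simp add: power_mult_distrib)
  have "\<alpha> / 2 * (1 - M * (2 - \<alpha>)) * (norm (y k - x (Suc k)))\<^sup>2
      = (1 - M * (2 - \<alpha>)) / (2 * \<alpha>) * ?S"
    unfolding S using \<alpha>_pos by (simp add: field_simps power2_eq_square)
  also have "(1 - M * (2 - \<alpha>)) / (2 * \<alpha>) = \<alpha> / 2 * (1 - 1 / \<alpha>)\<^sup>2 + decrease_rate"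
    unfolding decrease_rate_def using \<alpha>_pos by (simp add: field_simps power2_eq_square)
  finally have gain: "\<alpha> / 2 * (1 - M * (2 - \<alpha>)) * (norm (y k - x (Suc k)))\<^sup>2
      = \<alpha> / 2 * (1 - 1 / \<alpha>)\<^sup>2 * ?S + decrease_rate * ?S"
    by (simp add: distrib_right)
  have "0 \<le> \<alpha> / 2 * (1 - \<alpha> * (lam * L)) * (norm (x k - x (Suc k)))\<^sup>2"
    using \<alpha>_pos step_size by simp
  with objective_step[of k] inertia gain show ?thesis
    unfolding lyapunov_def diff_Suc_1 by linarith
qed

lemma lyapunov_decreasing: "1 \<le> k \<Longrightarrow> lyapunov (Suc k) \<le> lyapunov k"
  using lyapunov_step[of k] decrease_rate_pos
  by (smt (verit) mult_nonneg_nonneg zero_le_power2)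

lemma objective_le_lyapunov: "objective (y k) \<le> lyapunov k"
  using \<alpha>_pos by (simp add: lyapunov_def)

lemma lyapunov_bounded_below:
  obtains B where "\<And>k. B \<le> lyapunov k"
proof -
  obtain Bf Bp where B: "\<And>z. Bf \<le> f z" "\<And>z. Bp \<le> p z"
    using bdd_below_f bdd_below_p unfolding bdd_below_def by auto
  have "lam * Bf + Bp \<le> lyapunov k" for k
  proof (rule order_trans[OF _ objective_le_lyapunov])
    show "lam * Bf + Bp \<le> objective (y k)"
      unfolding objective_def using lam_pos B by (intro add_mono mult_left_mono) auto
  qed
  then show ?thesis by (rule that)
qed

lemma lyapunov_convergent: "convergent lyapunov"
proof -
  obtain B where "\<And>k. B \<le> lyapunov k" by (rule lyapunov_bounded_below) blast
  moreover have "decseq (\<lambda>k. lyapunov (Suc k))"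
    by (intro decseq_SucI lyapunov_decreasing) simp
  ultimately have "convergent (\<lambda>k. lyapunov (Suc k))"
    by (metis convergentI decseq_convergent)
  then show ?thesis by (simp add: convergent_Suc_iff)
qed

lemma steps_square_summable: "summable (\<lambda>k. (norm (y (Suc k) - y k))\<^sup>2)"
proof -
  obtain B where B: "\<And>k. B \<le> lyapunov k" by (rule lyapunov_bounded_below) blast
  let ?s = "\<lambda>k. (norm (y (Suc (Suc k)) - y (Suc k)))\<^sup>2"
  have "(\<Sum>k<n. decrease_rate * ?s k) \<le> lyapunov 1 - lyapunov (Suc n)" for n
  proof (induction n)
    case (Suc n)
    then show ?case using lyapunov_step[of "Suc n"] by simp
  qed simp
  then have "(\<Sum>k<n. decrease_rate * ?s k) \<le> lyapunov 1 - B" for n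
    using B[of "Suc n"] by (meson diff_left_mono order_trans)
  then have "summable (\<lambda>k. decrease_rate * ?s k)"
    using decrease_rate_pos by (intro summableI_nonneg_bounded) auto
  then have "summable ?s"
    using decrease_rate_pos by (simp add: summable_cmult_iff)
  then show ?thesis
    by (simp only: summable_Suc_iff[where f = "\<lambda>k. (norm (y (Suc k) - y k))\<^sup>2"])
qed

lemma steps_tendsto_zero: "(\<lambda>k. y (Suc k) - y k) \<longlonglongrightarrow> 0"
proof -
  have "(\<lambda>k. sqrt ((norm (y (Suc k) - y k))\<^sup>2)) \<longlonglongrightarrow> sqrt 0"
    by (intro tendsto_real_sqrt summable_LIMSEQ_zero steps_square_summable)
  then show ?thesis by (simp add: tendsto_norm_zero_iff)
qed

text \<open>Consecutive \<open>y\<close> merge, and \<open>x (Suc k) - y k\<close> is a multiple of \<open>y (Suc k) - y k\<close>, so all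
  three sequences share their limit along a subsequence. The implicit gradient step is used between the
  indices \<open>r n + 1\<close> and \<open>r n + 2\<close>, since \<open>x (r n)\<close> itself may not come from a relaxation step when
  \<open>r n = 0\<close>.\<close>

lemma subsequential_limit_stationary:
  assumes r: "strict_mono r" and lim: "(y \<circ> r) \<longlonglongrightarrow> z"
  shows "lam *\<^sub>R df z + dp z = 0"
proof -
  define d where "d k = y (Suc k) - y k" for k
  have d0: "(\<lambda>n. d (r n)) \<longlonglongrightarrow> 0"
    using LIMSEQ_subseq_LIMSEQ[OF steps_tendsto_zero r] by (simp add: d_def o_def)
  have d1: "(\<lambda>n. d (Suc (r n))) \<longlonglongrightarrow> 0"
    using LIMSEQ_subseq_LIMSEQ[OF LIMSEQ_Suc[OF steps_tendsto_zero] r] by (simp add: d_def o_def)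
  have y0: "(\<lambda>n. y (r n)) \<longlonglongrightarrow> z"
    using lim by (simp add: o_def)
  have y1: "(\<lambda>n. y (Suc (r n))) \<longlonglongrightarrow> z"
    using tendsto_add[OF y0 d0] by (simp add: d_def)
  have x_eq: "x (Suc k) = y k + (1 / \<alpha>) *\<^sub>R d k" for k
  proof -
    have "d k = \<alpha> *\<^sub>R (x (Suc k) - y k)"
      by (simp add: d_def y_step algebra_simps)
    then show ?thesis using \<alpha>_pos by simp
  qed
  have x1: "(\<lambda>n. x (Suc (r n))) \<longlonglongrightarrow> z"
    using tendsto_add[OF y0 tendsto_scaleR[OF tendsto_const d0]] by (simp add: x_eq)
  have x2: "(\<lambda>n. x (Suc (Suc (r n)))) \<longlonglongrightarrow> z"
    using tendsto_add[OF y1 tendsto_scaleR[OF tendsto_const d1]] by (simp add: x_eq)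
  have "(\<lambda>n. q (Suc (Suc (r n)))) \<longlonglongrightarrow> (1 - \<alpha>) *\<^sub>R z + \<alpha> *\<^sub>R z"
    unfolding q_step by (intro tendsto_intros y1 x1)
  then have q2: "(\<lambda>n. q (Suc (Suc (r n)))) \<longlonglongrightarrow> z"
    by (simp add: algebra_simps)
  have "isCont df z" "isCont dp z"
    using lipschitz_on_continuous_on[OF lipschitz_df] continuous_dp
    by (auto simp: continuous_on_eq_continuous_at)
  then have df: "(\<lambda>n. df (q (Suc (Suc (r n))))) \<longlonglongrightarrow> df z"
    and dp: "(\<lambda>n. dp (x (Suc (Suc (r n))))) \<longlonglongrightarrow> dp z"
    using q2 x2 by (auto intro: isCont_tendsto_compose)
  have dp_eq: "dp (x (Suc k)) = x k - lam *\<^sub>R df (q (Suc k)) - x (Suc k)" for k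
    using x_step[of k] by (simp add: algebra_simps eq_diff_eq)
  have "(\<lambda>n. dp (x (Suc (Suc (r n))))) \<longlonglongrightarrow> z - lam *\<^sub>R df z - z"
    unfolding dp_eq by (intro tendsto_intros x1 x2 df)
  with dp have "dp z = z - lam *\<^sub>R df z - z"
    by (rule LIMSEQ_unique)
  then show ?thesis by simp
qed

text \<open>From index \<open>1\<close> on, the iterates stay in a sublevel set of \<open>p\<close>, because the objective is below
  the decreasing Lyapunov function and \<open>f\<close> is bounded below.\<close>

lemma subsequence_to_critical_point:
  assumes "\<And>c. bounded {z. p z \<le> c}"
  obtains r z where "strict_mono r" "(y \<circ> r) \<longlonglongrightarrow> z" "critical_point (\<lambda>w. ereal (objective w)) z"
proof -
  obtain B where B: "\<And>z. B \<le> f z"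
    using bdd_below_f unfolding bdd_below_def by auto
  have "lyapunov (Suc k) \<le> lyapunov 1" for k
    by (induction k) (auto intro: order_trans[OF lyapunov_decreasing])
  then have "objective (y (Suc k)) \<le> lyapunov 1" for k
    using objective_le_lyapunov order_trans by blast
  then have "p (y (Suc k)) \<le> lyapunov 1 - lam * B" for k
    using mult_left_mono[OF B[of "y (Suc k)"], of lam] lam_pos
    unfolding objective_def by (smt (verit))
  then have "bounded (range (\<lambda>k. y (Suc k)))"
    by (intro bounded_subset[OF assms[of "lyapunov 1 - lam * B"]]) auto
  then obtain s z where s: "strict_mono s" "((\<lambda>k. y (Suc k)) \<circ> s) \<longlonglongrightarrow> z"
    using bounded_imp_convergent_subsequence by blast
  have r: "strict_mono (Suc \<circ> s)"
    using s(1) by (simp add: strict_mono_def)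
  have lim: "(y \<circ> (Suc \<circ> s)) \<longlonglongrightarrow> z"
    using s(2) by (simp add: o_def)
  have "GDERIV (\<lambda>w. lam * f w + p w) z :> lam *\<^sub>R df z + dp z"
    using GDERIV_add[OF GDERIV_mult[OF GDERIV_const gderiv_f] gderiv_p, of lam z] by simp
  then have "critical_point (\<lambda>w. ereal (objective w)) z"
    unfolding subsequential_limit_stationary[OF r lim]
    by (simp add: objective_def ereal_gderiv_zero_imp_critical_point)
  with r lim show ?thesis by (rule that)
qed

end

text \<open>The square of the minimum over the first \<open>K\<close> terms is at most their mean square, hence at most
  \<open>1/K\<close> times the whole series.\<close>

lemma running_minimum_rate:
  fixes s :: "nat \<Rightarrow> real"
  assumes nonneg: "\<And>k. 0 \<le> s k" and summable: "summable (\<lambda>k. (s k)\<^sup>2)"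
  shows "(\<lambda>K. Min (s ` {..<K})) \<in> O(\<lambda>K. 1 / sqrt (real K))"
proof (rule landau_o.bigI)
  let ?T = "\<Sum>k. (s k)\<^sup>2"
  \<comment> \<open>adding \<open>1\<close> keeps the constant positive when \<open>s\<close> vanishes\<close>
  show "0 < sqrt ?T + 1"
    by (intro add_nonneg_pos real_sqrt_ge_zero suminf_nonneg summable) auto
  show "\<forall>\<^sub>F K in sequentially. norm (Min (s ` {..<K})) \<le> (sqrt ?T + 1) * norm (1 / sqrt (real K))"
    using eventually_gt_at_top[of 0]
  proof eventually_elim
    case (elim K)
    let ?m = "Min (s ` {..<K})"
    have "?m \<in> s ` {..<K}"
      using elim by (intro Min_in) auto
    then have m: "0 \<le> ?m" using nonneg by auto
    have "real K * ?m\<^sup>2 = (\<Sum>k<K. ?m\<^sup>2)" by simp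
    also have "\<dots> \<le> (\<Sum>k<K. (s k)\<^sup>2)"
      using m by (intro sum_mono power_mono) auto
    also have "\<dots> \<le> ?T"
      by (intro sum_le_suminf summable) auto
    finally have "sqrt (real K * ?m\<^sup>2) \<le> sqrt ?T" by (rule real_sqrt_le_mono)
    then have "sqrt (real K) * ?m \<le> sqrt ?T + 1"
      using m by (simp add: real_sqrt_mult)
    then show ?case
      using m elim by (simp add: field_simps)
  qed
qed

section \<open>The potential of the denoiser\<close>

lemma id_minus_contraction_expansive:
  fixes G :: "'a::real_normed_vector \<Rightarrow> 'a"
  assumes "L-lipschitz_on UNIV G"
  shows "(1 - L) * norm (u - v) \<le> norm ((u - G u) - (v - G v))"
proof -
  have "norm (G u - G v) \<le> L * norm (u - v)"
    using lipschitz_onD[OF assms, of u v] by (simp add: dist_norm)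
  moreover have "norm (u - v) - norm (G u - G v) \<le> norm ((u - v) - (G u - G v))"
    by (rule norm_triangle_ineq2)
  ultimately show ?thesis by (simp add: algebra_simps)
qed

lemma id_minus_contraction_bij:
  fixes G :: "'a::banach \<Rightarrow> 'a"
  assumes lip: "L-lipschitz_on UNIV G" and L: "L < 1"
  shows "bij (\<lambda>u. u - G u)"
proof (rule bijI)
  show "inj (\<lambda>u. u - G u)"
  proof (rule injI)
    fix u v assume "u - G u = v - G v"
    then have "(1 - L) * norm (u - v) \<le> 0"
      using id_minus_contraction_expansive[OF lip, of u v] by simp
    then show "u = v" using L by (simp add: mult_le_0_iff)
  qed
  show "surj (\<lambda>u. u - G u)"
  proof (unfold surj_def, rule allI)
    fix z
    have "\<exists>!u. z + G u = u"
      using lipschitz_on_nonneg[OF lip] lipschitz_onD[OF lip] L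
      by (intro banach_fix_type[of L]) auto
    then show "\<exists>u. z = u - G u" by (metis add_diff_cancel_right')
  qed
qed

text \<open>Minimality of \<open>z = D (S z)\<close> says that \<open>p\<close> has the lower quadratic bound with slope \<open>S z - z\<close>
  at every \<open>z\<close>. The bound at \<open>w\<close>, read at \<open>z\<close>, is an upper bound for \<open>p w\<close> with slope \<open>S w - w\<close>;
  replacing it by \<open>S z - z\<close> costs a quadratic error because \<open>S\<close> is Lipschitz.\<close>

lemma gderiv_of_prox_surjective:
  fixes p :: "'a::real_inner \<Rightarrow> real"
  assumes prox: "\<And>u. prox (\<lambda>z. ereal (p z)) u = {D u}"
    and inverse: "\<And>z. D (S z) = z"
    and lip: "C-lipschitz_on UNIV S"
  shows "GDERIV p z :> S z - z"
proof (rule gderiv_of_quadratic_bound)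
  have lower: "p z + inner (S z - z) (w - z) - 1 / 2 * (norm (w - z))\<^sup>2 \<le> p w" for z w
  proof -
    have "z \<in> prox (\<lambda>z. ereal (p z)) (S z)"
      using prox inverse by auto
    then have "1 / 2 * (norm (S z - z))\<^sup>2 + p z \<le> 1 / 2 * (norm (S z - w))\<^sup>2 + p w"
      by (auto simp: prox_def is_arg_min_linorder)
    moreover have "(norm (S z - w))\<^sup>2
        = (norm (S z - z))\<^sup>2 - 2 * inner (S z - z) (w - z) + (norm (w - z))\<^sup>2"
      unfolding power2_norm_eq_inner by (simp add: inner_diff inner_commute algebra_simps)
    ultimately show ?thesis by linarith
  qed
  fix w
  have "inner (S w - S z) (w - z) \<le> C * (norm (w - z))\<^sup>2"
  proof -
    have "inner (S w - S z) (w - z) \<le> norm (S w - S z) * norm (w - z)"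
      by (rule norm_cauchy_schwarz)
    also have "\<dots> \<le> (C * norm (w - z)) * norm (w - z)"
      using lipschitz_onD[OF lip, of w z] by (intro mult_right_mono) (auto simp: dist_norm)
    finally show ?thesis by (simp add: power2_eq_square)
  qed
  moreover have "p w \<le> p z - inner (S w - w) (z - w) + 1 / 2 * (norm (w - z))\<^sup>2"
    using lower[of w z] by (simp add: norm_minus_commute)
  moreover have "inner (S w - w) (z - w)
      = - inner (S z - z) (w - z) - inner (S w - S z) (w - z) + (norm (w - z))\<^sup>2"
    unfolding power2_norm_eq_inner by (simp add: inner_diff inner_commute)
  moreover have "0 \<le> C * (norm (w - z))\<^sup>2"
    using lipschitz_on_nonneg[OF lip] by simp
  ultimately show "\<bar>p w - p z - inner (S z - z) (w - z)\<bar> \<le> (C + 1) * (norm (w - z))\<^sup>2"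
    using lower[of z w] zero_le_power2[of "norm (w - z)"] unfolding abs_le_iff distrib_right
    by linarith
qed

text \<open>Vectors of variable dimension form no normed space, so differentiability is expressed
  coordinatewise, for the network composed with a differentiable family \<open>c\<close> of inputs. The arbitrary \<open>c\<close>
  makes the induction pass through compositions.\<close>

lemma softplus_net_differentiable:
  fixes c :: "'a::real_normed_vector \<Rightarrow> real Matrix.vec"
  assumes "softplus_net \<epsilon> n m u"
    and "\<And>w. c w \<in> carrier_vec n"
    and "\<And>i. i < n \<Longrightarrow> (\<lambda>w. vec_index (c w) i) differentiable (at z)"
  shows "(\<forall>w. u (c w) \<in> carrier_vec m) \<and> (\<forall>i<m. (\<lambda>w. vec_index (u (c w)) i) differentiable (at z))"
  using assms
proof (induction arbitrary: c rule: softplus_net.induct)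
  case (affine A m n b)
  have "vec_index (A *\<^sub>v c w + b) i = (\<Sum>j<n. A $$ (i, j) * vec_index (c w) j) + vec_index b i"
    if "i < m" for i w
    using affine.hyps affine.prems(1)[of w] that
    by (auto simp: mult_mat_vec_def scalar_prod_def lessThan_atLeast0)
  then have "(\<lambda>w. vec_index (A *\<^sub>v c w + b) i) differentiable (at z)" if "i < m" for i
    using that affine.prems(2) by (simp add: differentiable_add differentiable_sum differentiable_mult)
  moreover have "A *\<^sub>v c w + b \<in> carrier_vec m" for w
    using affine by (intro add_carrier_vec mult_mat_vec_carrier)
  ultimately show ?case by blast
next
  case (activation n)
  have "(\<lambda>w. softplus \<epsilon> (vec_index (c w) i)) differentiable (at z)" if i: "i < n" for i
  proof -
    obtain B where B: "((\<lambda>w. vec_index (c w) i) has_derivative B) (at z)"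
      using activation.prems(2)[OF i] by (auto simp: differentiable_def)
    have "(softplus \<epsilon> has_real_derivative (1 / \<epsilon> * (exp (\<epsilon> * t) * \<epsilon> / (1 + exp (\<epsilon> * t))))) (at t)" for t
      unfolding softplus_def
      by (rule derivative_eq_intros refl | simp add: add_pos_pos)+
    then show ?thesis
      using has_derivative_compose[OF B] unfolding differentiable_def has_field_derivative_def by blast
  qed
  moreover have "vec_index (map_vec (softplus \<epsilon>) (c w)) i = softplus \<epsilon> (vec_index (c w) i)"
    if "i < n" for i w
    using activation.prems(1)[of w] that by auto
  moreover have "map_vec (softplus \<epsilon>) (c w) \<in> carrier_vec n" for w
    using activation.prems(1)[of w] by auto
  ultimately show ?case by simp
next
  case (compose n m u p w)
  have "\<And>a. u (c a) \<in> carrier_vec m"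
    and "\<And>i. i < m \<Longrightarrow> (\<lambda>a. vec_index (u (c a)) i) differentiable (at z)"
    using compose.IH(1)[OF compose.prems] by auto
  then show ?case
    using compose.IH(2)[of "\<lambda>a. u (c a)"] by simp
next
  case (sum n m u w)
  have u: "\<And>a. u (c a) \<in> carrier_vec m" "\<And>i. i < m \<Longrightarrow> (\<lambda>a. vec_index (u (c a)) i) differentiable (at z)"
    and w: "\<And>a. w (c a) \<in> carrier_vec m" "\<And>i. i < m \<Longrightarrow> (\<lambda>a. vec_index (w (c a)) i) differentiable (at z)"
    using sum by auto
  have "vec_index (u (c a) + w (c a)) i = vec_index (u (c a)) i + vec_index (w (c a)) i"
    if "i < m" for i a
    using w(1)[of a] that by auto
  then show ?case using u w by (simp add: differentiable_add)
next
  case (concat n m u p w)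
  have u: "\<And>a. u (c a) \<in> carrier_vec m" "\<And>i. i < m \<Longrightarrow> (\<lambda>a. vec_index (u (c a)) i) differentiable (at z)"
    and w: "\<And>a. w (c a) \<in> carrier_vec p" "\<And>i. i < p \<Longrightarrow> (\<lambda>a. vec_index (w (c a)) i) differentiable (at z)"
    using concat by auto
  have "vec_index (u (c a) @\<^sub>v w (c a)) i
      = (if i < m then vec_index (u (c a)) i else vec_index (w (c a)) (i - m))"
    if "i < m + p" for i a
    using u(1)[of a] w(1)[of a] that by auto
  then have "(\<lambda>a. vec_index (u (c a) @\<^sub>v w (c a)) i) differentiable (at z)" if "i < m + p" for i
    using that u(2) w(2) by (cases "i < m") auto
  then show ?case using u(1) w(1) by simp
qed

lemma denoiser_potential_differentiable:
  fixes N :: "real ^ 'n::finite \<Rightarrow> real ^ 'n"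
  assumes "softplus_network \<epsilon> N"
  shows "denoiser_potential N differentiable (at z)"
proof -
  obtain e u where e: "bij_betw e {..<CARD('n)} (UNIV :: 'n set)"
    and u: "softplus_net \<epsilon> CARD('n) CARD('n) u"
    and N: "\<And>w. coordinates e (N w) = u (coordinates e w)"
    using assms by (auto simp: softplus_network_def)
  have component: "(\<lambda>w. vec_nth w i) differentiable (at z)" for i :: 'n
    by (intro bounded_linear_imp_differentiable bounded_linear_vec_nth)
  have net: "(\<lambda>w. vec_index (u (coordinates e w)) i) differentiable (at z)" if "i < CARD('n)" for i
    using softplus_net_differentiable[OF u, of "coordinates e" z] that component
    by (simp add: coordinates_def)
  have "(\<lambda>w. vec_nth (N w) i) differentiable (at z)" for i
  proof -
    obtain j where j: "j < CARD('n)" "i = e j"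
      using e by (auto simp: bij_betw_def)
    have "vec_nth (N w) i = vec_index (u (coordinates e w)) j" for w
      using j unfolding N[symmetric] by (simp add: coordinates_def)
    then show ?thesis using net[OF j(1)] by simp
  qed
  moreover have "denoiser_potential N = (\<lambda>w. 1 / 2 * (\<Sum>i\<in>UNIV. (vec_nth w i - vec_nth (N w) i)\<^sup>2))"
    unfolding denoiser_potential_def power2_norm_eq_inner
    by (simp add: inner_vec_def power2_eq_square)
  ultimately show ?thesis
    using component
    by (simp add: differentiable_sum differentiable_mult differentiable_power differentiable_diff)
qed

text \<open>This turns the extended-valued \<open>\<phi>\<close> into a smooth real function \<open>p\<close>, with \<open>S\<close> the inverse of
  the denoiser. The comparison with the denoiser potential \<open>g\<close> is the descent lemma from \<open>S z\<close> to
  \<open>z\<close>: as \<open>z - S z\<close> is minus the gradient of \<open>g\<close> at \<open>S z\<close>, it gives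
  \<open>g z \<le> g (S z) - (1 - Lg / 2) \<parallel>S z - z\<parallel>\<^sup>2\<close>, and \<open>1 - Lg / 2 \<ge> 1 / 2\<close>.\<close>

lemma denoiser_prox_potential_smooth:
  fixes N :: "'a::euclidean_space \<Rightarrow> 'a"
  assumes pot: "denoiser_prox_potential N Lg \<phi>"
    and diff: "\<And>z. denoiser_potential N differentiable (at z)"
    and lip: "Lg-lipschitz_on UNIV (gradient (denoiser_potential N))"
    and Lg: "Lg < 1"
  obtains p S K where
    "\<phi> = (\<lambda>z. ereal (p z))"
    "convex_on UNIV (\<lambda>z. p z + (Lg / (Lg + 1)) / 2 * (norm z)\<^sup>2)"
    "\<And>z. GDERIV p z :> S z - z"
    "\<And>u. S (denoiser N u) = u"
    "continuous_on UNIV S"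
    "\<And>z. denoiser_potential N z + K \<le> p z"
proof -
  define g where "g = denoiser_potential N"
  define D where "D = denoiser N"
  have D_eq: "D = (\<lambda>u. u - gradient g u)"
    by (simp add: D_def g_def denoiser_def fun_eq_iff)
  have bij: "bij D"
    unfolding D_eq g_def using lip Lg by (rule id_minus_contraction_bij)
  define S where "S = inv_into UNIV D"
  have DS: "D (S z) = z" and SD: "S (D u) = u" for z u
    using bij by (simp_all add: S_def bij_inv_eq_iff bij_is_surj surj_f_inv_f bij_is_inj)
  have S_lip: "(1 / (1 - Lg))-lipschitz_on UNIV S"
  proof (rule lipschitz_onI)
    fix z w
    have "(1 - Lg) * norm (S z - S w) \<le> norm (D (S z) - D (S w))"
      unfolding D_eq using id_minus_contraction_expansive lip unfolding g_def by blast
    then show "dist (S z) (S w) \<le> 1 / (1 - Lg) * dist z w"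
      using Lg by (simp add: DS dist_norm field_simps)
  qed (use Lg in simp)
  obtain K where K: "\<And>z. z \<in> range D \<Longrightarrow> \<phi> z = ereal (g (S z) - 1 / 2 * (norm (S z - z))\<^sup>2 + K)"
    using pot unfolding denoiser_prox_potential_def D_def[symmetric] g_def[symmetric] S_def[symmetric]
    by blast
  define p where "p z = g (S z) - 1 / 2 * (norm (S z - z))\<^sup>2 + K" for z
  have \<phi>: "\<phi> = (\<lambda>z. ereal (p z))"
    using K bij by (auto simp: p_def bij_is_surj)
  show ?thesis
  proof (rule that[OF \<phi>])
    have "ereal_convex (\<lambda>z. ereal (p z + Lg / (Lg + 1) / 2 * (norm z)\<^sup>2))"
      using pot unfolding denoiser_prox_potential_def weakly_convex_def \<phi> by simp
    then show "convex_on UNIV (\<lambda>z. p z + Lg / (Lg + 1) / 2 * (norm z)\<^sup>2)"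
      unfolding ereal_convex_def by (intro convex_onI) auto
    show "GDERIV p z :> S z - z" for z
    proof (rule gderiv_of_prox_surjective[OF _ DS S_lip])
      show "prox (\<lambda>z. ereal (p z)) u = {D u}" for u
        using pot unfolding denoiser_prox_potential_def \<phi> D_def by blast
    qed
    show "S (denoiser N u) = u" for u
      using SD by (simp add: D_def)
    show "continuous_on UNIV S"
      using S_lip by (rule lipschitz_on_continuous_on)
    show "denoiser_potential N z + K \<le> p z" for z
    proof -
      define v where "v = gradient g (S z)"
      have z: "z - S z = - v"
        using DS[of z] unfolding D_eq v_def by (simp add: algebra_simps)
      have "g z \<le> g (S z) + inner v (z - S z) + Lg / 2 * (norm (z - S z))\<^sup>2"
        unfolding v_def
        by (rule lipschitz_gradient_upper_bound[OF gderiv_gradient])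
          (use diff lip in \<open>auto simp: g_def\<close>)
      also have "\<dots> = g (S z) - (norm v)\<^sup>2 + Lg / 2 * (norm v)\<^sup>2"
        unfolding z by (simp add: power2_norm_eq_inner)
      also have "\<dots> \<le> g (S z) - 1 / 2 * (norm v)\<^sup>2"
        using mult_right_mono[of Lg 1 "(norm v)\<^sup>2"] Lg by simp
      also have "norm v = norm (S z - z)"
        using z by (metis norm_minus_cancel norm_minus_commute)
      finally show ?thesis by (simp add: p_def g_def)
    qed
  qed
qed

lemma coercive_sublevel_bounded:
  assumes "coercive h"
  shows "bounded {z. h z \<le> c}"
proof -
  have "\<forall>\<^sub>F z in at_infinity. c < h z"
    using assms unfolding coercive_def by (simp add: filterlim_at_top_dense)
  then obtain b where "\<And>z. b \<le> norm z \<Longrightarrow> c < h z"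
    by (auto simp: eventually_at_infinity)
  then show ?thesis
    by (intro boundedI[of _ b]) (metis linorder_not_le mem_Collect_eq nle_le)
qed

theorem corollary2:
  fixes f :: "real ^ 'n::finite \<Rightarrow> real"
    and N :: "real ^ 'n \<Rightarrow> real ^ 'n"
    and \<phi> F :: "real ^ 'n \<Rightarrow> ereal"
    and \<epsilon> Lf Lg M lam \<alpha> :: real
    and q x y :: "nat \<Rightarrow> real ^ 'n"
  assumes "convex_on UNIV f"
    and "\<forall>z. f differentiable (at z)"
    and "Lf-lipschitz_on UNIV (gradient f)"
    and "bdd_below (range f)"
    and "\<epsilon> > 0"
    and "softplus_network \<epsilon> N"
    and "Lg-lipschitz_on UNIV (gradient (denoiser_potential N))"
    and "Lg < 1"
    and "denoiser_prox_potential N Lg \<phi>"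
    and "M = Lg / (Lg + 1)"
    and "lam > 0"
    and "F = (\<lambda>z. ereal (lam * f z) + \<phi> z)"
    and "0 < \<alpha>" and "\<alpha> < 1"
    and "lam * Lf * M < 1"
    and "M < \<alpha>"
    and "ereal \<alpha> < 1 / ereal (lam * Lf)"  \<comment> \<open>in \<open>ereal\<close>, \<open>1 / 0 = \<infinity>\<close>\<close>
    and "\<forall>k. q (Suc k) = (1 - \<alpha>) *\<^sub>R y k + \<alpha> *\<^sub>R x k"
    and "\<forall>k. x (Suc k) = denoiser N (x k - lam *\<^sub>R gradient f (q (Suc k)))"
    and "\<forall>k. y (Suc k) = (1 - \<alpha>) *\<^sub>R y k + \<alpha> *\<^sub>R x (Suc k)"
  shows "(let E = (\<lambda>k. F (y k) + ereal (\<alpha> / 2 * (1 - 1 / \<alpha>)\<^sup>2 * (norm (y k - y (k - 1)))\<^sup>2))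
          in (\<forall>k\<ge>1. E (Suc k) \<le> E k) \<and> (\<exists>l::real. E \<longlonglongrightarrow> ereal l))
       \<and> summable (\<lambda>k. (norm (y (Suc k) - y k))\<^sup>2)
       \<and> (\<lambda>k. norm (y (Suc k) - y k)) \<longlonglongrightarrow> 0
       \<and> (\<lambda>K. Min ((\<lambda>k. norm (y (Suc k) - y k)) ` {..<K})) \<in> O(\<lambda>K. 1 / sqrt (real K))
       \<and> (coercive (denoiser_potential N) \<longrightarrow>
            (\<exists>r z. strict_mono r \<and> (y \<circ> r) \<longlonglongrightarrow> z \<and> critical_point F z))"
proof -
  note convex_f = assms(1) and diff_f = assms(2)[rule_format] and lip_f = assms(3)
    and bdd_f = assms(4) and net = assms(6) and lip_g = assms(7) and Lg = assms(8)
    and pot = assms(9) and M = assms(10) and lam = assms(11) and F = assms(12)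
    and \<alpha> = assms(13,14) and M\<alpha> = assms(16) and step = assms(17)
    and iterates = assms(18-20)[rule_format]
  obtain p S K where \<phi>: "\<phi> = (\<lambda>z. ereal (p z))"
    and weak: "convex_on UNIV (\<lambda>z. p z + (Lg / (Lg + 1)) / 2 * (norm z)\<^sup>2)"
    and grad_p: "\<And>z. GDERIV p z :> S z - z"
    and S: "\<And>u. S (denoiser N u) = u" "continuous_on UNIV S"
    and lower: "\<And>z. denoiser_potential N z + K \<le> p z"
    using denoiser_prox_potential_smooth[OF pot denoiser_potential_differentiable[OF net] lip_g Lg]
    by blast
  have "\<alpha> * (lam * Lf) \<le> 1"
  proof (cases "lam * Lf = 0")
    case False
    then have "0 < lam * Lf"
      using lam lipschitz_on_nonneg[OF lip_f] by (simp add: less_le)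
    moreover have "\<alpha> < 1 / (lam * Lf)"
      using step False by (simp add: one_ereal_def)
    ultimately show ?thesis by (simp add: less_divide_eq)
  qed auto
  moreover have "K \<le> p z" for z
    using lower[of z] by (simp add: denoiser_potential_def order_trans[rotated])
  then have "bdd_below (range p)"
    by (auto simp: bdd_below_def)
  ultimately interpret relaxed_proximal_gradient f p "gradient f" "\<lambda>z. S z - z" Lf M lam \<alpha> q x y
    using convex_f diff_f lip_f bdd_f weak grad_p S lam \<alpha> M\<alpha> iterates
    by unfold_locales (auto simp: M gderiv_gradient intro!: continuous_intros)
  have F_eq: "F = (\<lambda>z. ereal (objective z))"
    by (simp add: F \<phi> objective_def fun_eq_iff)
  define E where "E k = F (y k) + ereal (\<alpha> / 2 * (1 - 1 / \<alpha>)\<^sup>2 * (norm (y k - y (k - 1)))\<^sup>2)" for k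
  have E: "E = (\<lambda>k. ereal (lyapunov k))"
    by (simp add: E_def F_eq lyapunov_def fun_eq_iff)
  have "\<forall>k\<ge>1. E (Suc k) \<le> E k"
    unfolding E using lyapunov_decreasing by simp
  moreover have "\<exists>l::real. E \<longlonglongrightarrow> ereal l"
    using lyapunov_convergent unfolding E convergent_def by (auto intro: tendsto_ereal)
  moreover have "(\<lambda>K. Min ((\<lambda>k. norm (y (Suc k) - y k)) ` {..<K})) \<in> O(\<lambda>K. 1 / sqrt (real K))"
    using steps_square_summable by (intro running_minimum_rate) auto
  moreover have "\<exists>r z. strict_mono r \<and> (y \<circ> r) \<longlonglongrightarrow> z \<and> critical_point F z"
    if coercive: "coercive (denoiser_potential N)"
  proof -
    have "bounded {z. p z \<le> c}" for c
    proof (rule bounded_subset[OF coercive_sublevel_bounded[OF coercive, of "c - K"]])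
      show "{z. p z \<le> c} \<subseteq> {z. denoiser_potential N z \<le> c - K}"
        using lower by (auto intro: order_trans simp: le_diff_eq)
    qed
    then show ?thesis
      using subsequence_to_critical_point unfolding F_eq by metis
  qed
  ultimately show ?thesis
    using steps_square_summable tendsto_norm_zero[OF steps_tendsto_zero]
    unfolding Let_def E_def by blast
qed

end
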